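(* Let $\{p_n(\lambda)\}_{n=0}^\infty$ be the associated polynomials of the Jacobi-type pencil $\Theta_1$, i.e. the polynomials determined by $p_0(\lambda)=1$, $p_1(\lambda)=\sqrt{2}\lambda+\sqrt{2}$ and $$p_{n-2}(\lambda)-\sqrt{2}\lambda p_{n-1}(\lambda)-2\lambda p_n(\lambda)-\sqrt{2}\lambda p_{n+1}(\lambda)+p_{n+2}(\lambda)=0,\qquad n\in\mathbb{Z}_+,$$ where $p_{-2}(\lambda)=p_{-1}(\lambda)=0$. Then $$p_n(\sqrt{2}t-1)=T_n(t)+tU_{n-1}(t)-\frac12\,\frac{U_{n-1}(t)-U_{n-1}\left(-\frac{1}{\sqrt2}\right)}{t+\frac{1}{\sqrt2}}$$ for all $n\in\mathbb{Z}_+$ and all $t\in\left(-1,-\frac{1}{\sqrt2}\right)\cup\left(-\frac{1}{\sqrt2},1\right)$.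
   Context: $\mathbb{Z}_+$ denotes the set of non-negative integers. For $t\in(-1,1)$, $T_n(t)=\cos(n\arccos t)$ and $U_n(t)=\frac{\sin((n+1)\arccos t)}{\sqrt{1-t^2}}$ are Chebyshev's polynomials of the first and second kind, with $U_{-1}=0$. A Jacobi-type pencil is a set $\Theta=(J_3,J_5,\alpha,\beta)$, where $\alpha>0$, $\beta\in\mathbb{R}$, $J_3$ is a semi-infinite Jacobi matrix (real symmetric tridiagonal, with diagonal entries $b_k\in\mathbb{R}$ and off-diagonal entries $a_k>0$, $k\in\mathbb{Z}_+$), and $J_5$ is a semi-infinite real symmetric five-diagonal matrix with diagonal entries $\alpha_n\in\mathbb{R}$, first subdiagonal entries $\beta_n\in\mathbb{R}$ and second subdiagonal entries $\gamma_n>0$, $n\in\mathbb{Z}_+$. The associated polynomials of $\Theta$ are the polynomials $\{p_n\}_{n=0}^\infty$ with $p_0(\lambda)=1$, $p_1(\lambda)=\alpha\lambda+\beta$ and $(J_5-\lambda J_3)(p_0(\lambda),p_1(\lambda),p_2(\lambda),\dots)^T=0$. The pencil $\Theta_1$ is the Jacobi-type pencil with $\alpha=\beta=\sqrt2$, $a_k=\sqrt2$, $b_k=2$, $\alpha_k=\beta_k=0$, $\gamma_k=1$ for all $k\in\mathbb{Z}_+$; for it, this defining relation is exactly the recurrence in the claim. *)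

theory Defs
  imports Complex_Main "HOL-Computational_Algebra.Polynomial"
begin

text \<open>These are the Chebyshev functions only for arguments strictly between -1 and 1.
  The index of U is an integer because index -1 is needed; the formula gives the value 0 there.\<close>

definition chebyshev_T :: "nat \<Rightarrow> real \<Rightarrow> real" where
  "chebyshev_T n t = cos (real n * arccos t)"

definition chebyshev_U :: "int \<Rightarrow> real \<Rightarrow> real" where
  "chebyshev_U n t = sin ((of_int n + 1) * arccos t) / sqrt (1 - t\<^sup>2)"

lemma chebyshev_U_minus_1: "chebyshev_U (-1) t = 0"
  by (simp add: chebyshev_U_def)

definition jacobi_matrix :: "(nat \<Rightarrow> real) \<Rightarrow> (nat \<Rightarrow> real) \<Rightarrow> nat \<Rightarrow> nat \<Rightarrow> real" where
  "jacobi_matrix a b m n =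
     (if m = n then b n
      else if m = Suc n then a n
      else if n = Suc m then a m
      else 0)"

definition five_diagonal_matrix ::
  "(nat \<Rightarrow> real) \<Rightarrow> (nat \<Rightarrow> real) \<Rightarrow> (nat \<Rightarrow> real) \<Rightarrow> nat \<Rightarrow> nat \<Rightarrow> real" where
  "five_diagonal_matrix d0 d1 d2 m n =
     (if m = n then d0 n
      else if m = Suc n then d1 n
      else if n = Suc m then d1 m
      else if m = n + 2 then d2 n
      else if n = m + 2 then d2 m
      else 0)"

text \<open>Only meaningful for matrices with finitely many nonzero entries in each row,
  such as the banded matrices used here.\<close>

definition mat_vec :: "(nat \<Rightarrow> nat \<Rightarrow> 'a::comm_ring_1) \<Rightarrow> (nat \<Rightarrow> 'a) \<Rightarrow> nat \<Rightarrow> 'a" where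
  "mat_vec M v m = (\<Sum>k | M m k \<noteq> 0. M m k * v k)"

record pencil =
  J3 :: "nat \<Rightarrow> nat \<Rightarrow> real"
  J5 :: "nat \<Rightarrow> nat \<Rightarrow> real"
  alpha :: real
  beta :: real

definition jacobi_type_pencil :: "pencil \<Rightarrow> bool" where
  "jacobi_type_pencil \<Theta> \<longleftrightarrow>
     alpha \<Theta> > 0 \<and>
     (\<exists>a b. (\<forall>k. a k > 0) \<and> J3 \<Theta> = jacobi_matrix a b) \<and>
     (\<exists>d0 d1 d2. (\<forall>k. d2 k > 0) \<and> J5 \<Theta> = five_diagonal_matrix d0 d1 d2)"

text \<open>The matrix \<open>J5 - \<lambda> J3\<close>, whose entries are polynomials in \<open>\<lambda>\<close>.\<close>

definition pencil_matrix :: "pencil \<Rightarrow> nat \<Rightarrow> nat \<Rightarrow> real poly" where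
  "pencil_matrix \<Theta> m k = [:J5 \<Theta> m k, - J3 \<Theta> m k:]"

definition associated_polynomials :: "pencil \<Rightarrow> (nat \<Rightarrow> real poly) \<Rightarrow> bool" where
  "associated_polynomials \<Theta> p \<longleftrightarrow>
     p 0 = 1 \<and>
     p 1 = [:beta \<Theta>, alpha \<Theta>:] \<and>
     (\<forall>m. mat_vec (pencil_matrix \<Theta>) p m = 0)"

lemma mat_vec_pencil_matrix:
  assumes "jacobi_type_pencil \<Theta>"
  shows "mat_vec (pencil_matrix \<Theta>) p m = (\<Sum>k\<le>m + 2. pencil_matrix \<Theta> m k * p k)"
  unfolding mat_vec_def
proof (rule sum.mono_neutral_cong_left)
  show "{k. pencil_matrix \<Theta> m k \<noteq> 0} \<subseteq> {..m + 2}"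
    using assms
    by (auto simp: jacobi_type_pencil_def pencil_matrix_def jacobi_matrix_def
        five_diagonal_matrix_def split: if_splits)
qed auto

lemma associated_polynomials_ex1:
  assumes \<Theta>: "jacobi_type_pencil \<Theta>"
  shows "\<exists>!p. associated_polynomials \<Theta> p"
proof -
  let ?M = "pencil_matrix \<Theta>"
  define c where "c m = J5 \<Theta> m (m + 2)" for m
  have c: "c m \<noteq> 0" "?M m (Suc (Suc m)) = [:c m:]" for m
  proof -
    obtain a b d0 d1 d2 where "\<forall>k. d2 k > 0" "J3 \<Theta> = jacobi_matrix a b"
      "J5 \<Theta> = five_diagonal_matrix d0 d1 d2"
      using \<Theta> by (auto simp: jacobi_type_pencil_def)
    then show "c m \<noteq> 0" "?M m (Suc (Suc m)) = [:c m:]"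
      by (auto simp: c_def pencil_matrix_def jacobi_matrix_def five_diagonal_matrix_def
          less_imp_neq[symmetric])
  qed
  define rhs where "rhs p m = smult (- 1 / c m) (\<Sum>k\<le>Suc m. ?M m k * p k)" for p m
  have rhs_cong: "rhs p m = rhs q m" if "\<And>k. k \<le> Suc m \<Longrightarrow> p k = q k" for p q m
    using that by (auto simp: rhs_def intro!: sum.cong arg_cong[where f = "smult _"])
  have row: "mat_vec ?M p m = 0 \<longleftrightarrow> p (Suc (Suc m)) = rhs p m" for p m
  proof -
    define S where "S = (\<Sum>k\<le>Suc m. ?M m k * p k)"
    have "mat_vec ?M p m = S + smult (c m) (p (Suc (Suc m)))"
      using mat_vec_pencil_matrix[OF \<Theta>, of p m] c(2)[of m] by (simp add: S_def)
    moreover have "S + smult (c m) q = 0 \<longleftrightarrow> q = smult (- 1 / c m) S" for q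
    proof
      assume "S + smult (c m) q = 0"
      then have "S = smult (- c m) q" by (simp add: add_eq_0_iff2)
      then show "q = smult (- 1 / c m) S" using c(1)[of m] by simp
    next
      assume "q = smult (- 1 / c m) S"
      then show "S + smult (c m) q = 0" using c(1)[of m] by simp
    qed
    ultimately show ?thesis by (simp add: rhs_def S_def)
  qed
  define F where "F p n = (if n = 0 then 1 else if n = 1 then [:beta \<Theta>, alpha \<Theta>:]
     else rhs p (n - 2))" for p :: "nat \<Rightarrow> real poly" and n :: nat
  have assoc: "associated_polynomials \<Theta> p \<longleftrightarrow> (\<forall>n. p n = F p n)" for p
  proof
    assume A: "associated_polynomials \<Theta> p"
    show "\<forall>n. p n = F p n"
    proof
      fix n show "p n = F p n"
        using A row[of p "n - 2"]
        by (cases n; cases "n - 1") (auto simp: associated_polynomials_def F_def)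
    qed
  next
    assume A: "\<forall>n. p n = F p n"
    have "p (Suc (Suc m)) = rhs p m" for m using A[rule_format, of "Suc (Suc m)"]
      by (simp add: F_def)
    then show "associated_polynomials \<Theta> p"
      using A[rule_format, of 0] A[rule_format, of 1] row
      by (auto simp: associated_polynomials_def F_def)
  qed
  have F_cong: "F p n = F q n" if "\<And>k. k < n \<Longrightarrow> p k = q k" for p q n
    using that by (auto simp: F_def intro!: rhs_cong)
  define w where "w = wfrec less_than F"
  have ex: "w n = F w n" for n
  proof -
    have "w n = F (cut w less_than n) n" unfolding w_def by (rule wfrec) simp
    also have "\<dots> = F w n" by (rule F_cong) (simp add: cut_apply)
    finally show ?thesis .
  qed
  have uniq: "p n = q n" if p: "\<And>n. p n = F p n" and q: "\<And>n. q n = F q n" for p q n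
  proof (induction n rule: less_induct)
    case (less n)
    then have "F p n = F q n" by (rule F_cong)
    then show ?case by (simp only: p[of n] q[of n])
  qed
  show ?thesis unfolding assoc
  proof (rule ex1I[of _ w])
    show "\<forall>n. w n = F w n" using ex by (rule allI)
    show "p = w" if "\<forall>n. p n = F p n" for p
      by (rule ext, rule uniq[OF that[rule_format] ex])
  qed
qed

definition Theta1 :: pencil where
  "Theta1 = \<lparr>
     J3 = jacobi_matrix (\<lambda>k. sqrt 2) (\<lambda>k. 2),
     J5 = five_diagonal_matrix (\<lambda>k. 0) (\<lambda>k. 0) (\<lambda>k. 1),
     alpha = sqrt 2,
     beta = sqrt 2\<rparr>"

lemma jacobi_type_pencil_Theta1: "jacobi_type_pencil Theta1"
  unfolding jacobi_type_pencil_def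
proof (intro conjI exI)
  show "\<forall>k. sqrt 2 > 0" by simp
  show "\<forall>k. (1::real) > 0" by simp
qed (simp_all add: Theta1_def)

text \<open>The system for this pencil is the scalar five-term recurrence, the terms of index
  -2 and -1 being zero.\<close>

lemma associated_polynomials_Theta1_iff:
  "associated_polynomials Theta1 p \<longleftrightarrow>
     p 0 = 1 \<and> p 1 = [:sqrt 2, sqrt 2:] \<and>
     (\<forall>n x. (if n \<ge> 2 then poly (p (n - 2)) x else 0)
         - sqrt 2 * x * (if n \<ge> 1 then poly (p (n - 1)) x else 0)
         - 2 * x * poly (p n) x
         - sqrt 2 * x * poly (p (n + 1)) x
         + poly (p (n + 2)) x = 0)"
proof -
  let ?M = "pencil_matrix Theta1"
  have M: "?M n k = (if n = k then [:0, -2:] else if n = Suc k \<or> k = Suc n then [:0, - sqrt 2:]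
      else if n = k + 2 \<or> k = n + 2 then 1 else 0)" for n k
    by (auto simp: pencil_matrix_def Theta1_def jacobi_matrix_def five_diagonal_matrix_def one_pCons)
  have row: "poly (mat_vec ?M p n) x =
      (if n \<ge> 2 then poly (p (n - 2)) x else 0)
         - sqrt 2 * x * (if n \<ge> 1 then poly (p (n - 1)) x else 0)
         - 2 * x * poly (p n) x
         - sqrt 2 * x * poly (p (n + 1)) x
         + poly (p (n + 2)) x" for n x
  proof -
    have *: "mat_vec ?M p n = (\<Sum>k\<le>n + 2. ?M n k * p k)"
      by (rule mat_vec_pencil_matrix[OF jacobi_type_pencil_Theta1])
    consider "n = 0" | "n = 1" | m where "n = m + 2"
      by (metis One_nat_def add_2_eq_Suc' not0_implies_Suc)
    then show ?thesis
    proof cases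
      case 1
      then show ?thesis unfolding * M by (simp add: numeral_2_eq_2 algebra_simps)
    next
      case 2
      then show ?thesis unfolding * M by (simp add: numeral_2_eq_2 algebra_simps)
    next
      case (3 m)
      have "(\<Sum>k<m. ?M n k * p k) = 0"
        by (rule sum.neutral) (auto simp: M 3)
      moreover have "{..n + 2} = {..<m} \<union> {m, m + 1, m + 2, m + 3, m + 4}"
        unfolding 3 by auto
      ultimately have "mat_vec ?M p n = (\<Sum>k\<in>{m, m + 1, m + 2, m + 3, m + 4}. ?M n k * p k)"
        using sum.union_disjoint[of "{..<m}" "{m, m + 1, m + 2, m + 3, m + 4}" "\<lambda>k. ?M n k * p k"]
        unfolding * by simp
      also have "\<dots> = p m + [:0, - sqrt 2:] * p (m + 1) + [:0, -2:] * p (m + 2)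
          + [:0, - sqrt 2:] * p (m + 3) + p (m + 4)"
        by (simp add: M 3)
      finally show ?thesis by (simp add: 3 algebra_simps eval_nat_numeral)
    qed
  qed
  have zero: "mat_vec ?M p n = 0 \<longleftrightarrow> (\<forall>x. poly (mat_vec ?M p n) x = 0)" for n
    by (simp add: poly_all_0_iff_0)
  show ?thesis
    unfolding associated_polynomials_def zero row by (simp add: Theta1_def)
qed

end

(* Since T_n + t U_{n-1} = U_n, the right-hand side, extended to all integers k, is
     F k = U_k(t) - (U_{k-1}(t) - U_{k-1}(-1/sqrt 2)) / (2 (t + 1/sqrt 2)).
   The three-term recurrence of U_k(c) makes it an eigenvector of the five-term operator for
   lambda = sqrt 2 t - 1, with eigenvalue proportional to (c - t) (c + 1/sqrt 2); this vanishes
   for both c = t and c = -1/sqrt 2, so F solves the recurrence.  The correction term is exactly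
   what enforces F(-1) = F(-2) = 0, and F 0 = 1, F 1 = 2t are the initial conditions. *)

theory Submission
  imports Defs
begin

text \<open>Addition formulas for the sine at
  \<open>(k + 2) * \<theta> \<plusminus> \<theta>\<close>. The index is any integer, so the
  recurrence can also be run backwards below index -1.\<close>

lemma chebyshev_U_rec:
  assumes "\<bar>t\<bar> \<le> 1"
  shows "chebyshev_U (k + 2) t = 2 * t * chebyshev_U (k + 1) t - chebyshev_U k t"
proof -
  define \<theta> where "\<theta> = arccos t"
  have t: "t = cos \<theta>"
    using assms by (simp add: \<theta>_def)
  define x where "x = (of_int k + 2) * \<theta>"
  have "sin (x + \<theta>) + sin (x - \<theta>) = 2 * t * sin x"
    by (simp add: sin_add sin_diff t)
  then have "sin ((of_int k + 3) * \<theta>) = 2 * t * sin ((of_int k + 2) * \<theta>) - sin ((of_int k + 1) * \<theta>)"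
    by (simp add: x_def algebra_simps)
  then show ?thesis
    by (simp add: chebyshev_U_def \<theta>_def [symmetric] diff_divide_distrib add.assoc)
qed

lemma chebyshev_U_0: "\<bar>t\<bar> < 1 \<Longrightarrow> chebyshev_U 0 t = 1"
  by (auto simp: chebyshev_U_def sin_arccos_abs abs_square_eq_1)

lemma chebyshev_T_plus_U:
  assumes "\<bar>t\<bar> < 1"
  shows "chebyshev_T n t + t * chebyshev_U (int n - 1) t = chebyshev_U (int n) t"
proof -
  have s: "sin (arccos t) = sqrt (1 - t\<^sup>2)" "cos (arccos t) = t" "sqrt (1 - t\<^sup>2) \<noteq> 0"
    using assms by (auto simp: sin_arccos_abs abs_square_eq_1)
  have "sin ((real n + 1) * arccos t) = sin (real n * arccos t) * t + cos (real n * arccos t) * sqrt (1 - t\<^sup>2)"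
    by (simp add: distrib_right sin_add s)
  then show ?thesis
    using s(3) by (simp add: chebyshev_T_def chebyshev_U_def field_simps)
qed

text \<open>The stencil is symmetric about \<open>k\<close>: the neighbours at distance 1 add up to
  \<open>2 * c * w k\<close>, those at distance 2 to
  \<open>(4 * c\<^sup>2 - 2) * w k\<close>.\<close>

lemma five_term_of_three_term:
  fixes w :: "int \<Rightarrow> real"
  assumes w: "\<And>k. w (k + 2) = 2 * c * w (k + 1) - w k"
  shows "w (k - 2) - sqrt 2 * x * w (k - 1) - 2 * x * w k - sqrt 2 * x * w (k + 1) + w (k + 2)
    = (4 * c\<^sup>2 - 2 - 2 * sqrt 2 * x * c - 2 * x) * w k"
proof -
  have 1: "w (k - 1) = 2 * c * w k - w (k + 1)"
    using w[of "k - 1"] by (simp add: algebra_simps)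
  have 2: "w (k - 2) = 2 * c * w (k - 1) - w k"
    using w[of "k - 2"] by (simp add: algebra_simps)
  show ?thesis
    unfolding 2 1 w[of k] by (simp add: algebra_simps power2_eq_square)
qed

theorem theorem1:
  fixes p :: "nat \<Rightarrow> real poly" and n :: nat and t :: real
  assumes "associated_polynomials Theta1 p"
    and "t \<in> {-1<..<- 1 / sqrt 2} \<union> {- 1 / sqrt 2<..<1}"
  shows "poly (p n) (sqrt 2 * t - 1) =
    chebyshev_T n t + t * chebyshev_U (int n - 1) t
      - 1 / 2 * ((chebyshev_U (int n - 1) t - chebyshev_U (int n - 1) (- 1 / sqrt 2))
                  / (t + 1 / sqrt 2))"
proof -
  define x where "x = sqrt 2 * t - 1"
  define c where "c = - 1 / sqrt (2::real)"
  define u where "u k = chebyshev_U k t" for k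
  define v where "v k = chebyshev_U k c" for k
  define F where "F k = u k - (u (k - 1) - v (k - 1)) / (2 * (t - c))" for k
  have c1: "\<bar>c\<bar> < 1"
    by (simp add: c_def)
  have t1: "\<bar>t\<bar> < 1" and tc: "t - c \<noteq> 0"
    using assms(2) c1 unfolding c_def[symmetric] by auto
  have c2: "sqrt 2 * c = -1" "c\<^sup>2 = 1 / 2"
    by (simp_all add: c_def power_divide)
  have u: "u (k + 2) = 2 * t * u (k + 1) - u k" for k
    using chebyshev_U_rec[of t k] t1 by (simp add: u_def)
  have v: "v (k + 2) = 2 * c * v (k + 1) - v k" for k
    using chebyshev_U_rec[of c k] c1 by (simp add: v_def)
  have u0: "u 0 = 1" "u (-1) = 0" and v0: "v 0 = 1" "v (-1) = 0"
    using t1 c1 by (simp_all add: u_def v_def chebyshev_U_0 chebyshev_U_minus_1)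
  \<comment> \<open>The three-term recurrence is run backwards from indices 0 and -1; index -3 is
    reached because \<open>F (-2)\<close> involves \<open>u (-3)\<close> and
    \<open>v (-3)\<close>.\<close>
  have u2: "u (-2) = -1" "u (-3) = - 2 * t" "u 1 = 2 * t"
    using u[of "-2"] u[of "-3"] u[of "-1"] u0 by simp_all
  have v2: "v (-2) = -1" "v (-3) = - 2 * c"
    using v[of "-2"] v[of "-3"] v0 by simp_all
  \<comment> \<open>At -2 the quotient is \<open>(2 * c - 2 * t) / (2 * (t - c)) = -1\<close>, which
    cancels \<open>u (-2)\<close>; this is where the factor 1/2 matters.\<close>
  have F0: "F 0 = 1" "F 1 = 2 * t" "F (-1) = 0" "F (-2) = 0"
    using tc by (simp_all add: F_def u0 v0 u2 v2 field_simps)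
  have lu: "u (k - 2) - sqrt 2 * x * u (k - 1) - 2 * x * u k - sqrt 2 * x * u (k + 1) + u (k + 2) = 0" for k
  proof -
    have "4 * t\<^sup>2 - 2 - 2 * sqrt 2 * x * t - 2 * x = 0"
      by (simp add: x_def algebra_simps power2_eq_square)
    then show ?thesis
      unfolding five_term_of_three_term[of u t, OF u] by simp
  qed
  have lv: "v (k - 2) - sqrt 2 * x * v (k - 1) - 2 * x * v k - sqrt 2 * x * v (k + 1) + v (k + 2) = 0" for k
  proof -
    \<comment> \<open>As \<open>sqrt 2 * c = -1\<close>, the terms in \<open>x\<close> cancel, so
      \<open>v\<close> solves the recurrence for every value of the spectral parameter.\<close>
    have "4 * c\<^sup>2 - 2 - 2 * sqrt 2 * x * c - 2 * x = 4 * c\<^sup>2 - 2 - 2 * x * (sqrt 2 * c) - 2 * x"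
      by simp
    also have "\<dots> = 0"
      unfolding c2 by simp
    finally show ?thesis
      unfolding five_term_of_three_term[of v c, OF v] by simp
  qed
  have F: "F (k + 2) = sqrt 2 * x * F (k + 1) + 2 * x * F k + sqrt 2 * x * F (k - 1) - F (k - 2)" for k
  proof -
    \<comment> \<open>Naming the constant factor makes \<open>F\<close> a linear combination of
      \<open>u\<close> and of shifts of \<open>u\<close> and \<open>v\<close>, leaving a polynomial
      identity free of division.\<close>
    define d where "d = 1 / (2 * (t - c))"
    have Fd: "F j = u j - d * (u (j - 1) - v (j - 1))" for j
      by (simp add: F_def d_def)
    have "u (k + 2) = sqrt 2 * x * u (k + 1) + 2 * x * u k + sqrt 2 * x * u (k - 1) - u (k - 2)"
      using lu[of k] by simp
    moreover have "u (k + 1) = sqrt 2 * x * u k + 2 * x * u (k - 1) + sqrt 2 * x * u (k - 2) - u (k - 3)"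
      using lu[of "k - 1"] by (simp add: add.commute)
    moreover have "v (k + 1) = sqrt 2 * x * v k + 2 * x * v (k - 1) + sqrt 2 * x * v (k - 2) - v (k - 3)"
      using lv[of "k - 1"] by (simp add: add.commute)
    moreover have "F (k + 2) = u (k + 2) - d * (u (k + 1) - v (k + 1))"
      "F (k + 1) = u (k + 1) - d * (u k - v k)"
      "F (k - 1) = u (k - 1) - d * (u (k - 2) - v (k - 2))"
      "F (k - 2) = u (k - 2) - d * (u (k - 3) - v (k - 3))"
      using Fd[of "k + 2"] Fd[of "k + 1"] Fd[of "k - 1"] Fd[of "k - 2"]
      by (simp_all add: add.commute)
    ultimately show ?thesis
      using Fd[of k] by algebra
  qed
  have p0: "p 0 = 1" and p1: "p 1 = [:sqrt 2, sqrt 2:]"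
    and p: "poly (p (n + 2)) x = sqrt 2 * x * poly (p (n + 1)) x + 2 * x * poly (p n) x
      + sqrt 2 * x * (if n \<ge> 1 then poly (p (n - 1)) x else 0)
      - (if n \<ge> 2 then poly (p (n - 2)) x else 0)" for n
    using assms(1) unfolding associated_polynomials_Theta1_iff by (simp_all add: algebra_simps)
  have "poly (p n) x = F (int n)"
  proof (induction n rule: less_induct)
    case (less n)
    consider "n = 0" | "n = 1" | m where "n = m + 2"
      by (metis One_nat_def add_2_eq_Suc' not0_implies_Suc)
    then show ?case
    proof cases
      case 1
      then show ?thesis by (simp add: p0 F0)
    next
      case 2
      then show ?thesis using F0 p1 by (simp add: x_def algebra_simps)
    next
      case (3 m)
      \<comment> \<open>The zero terms of the truncated recurrence for small \<open>m\<close> agree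
        with \<open>F (-1) = F (-2) = 0\<close>, so no separate boundary rows are needed.\<close>
      have "(if m \<ge> 1 then poly (p (m - 1)) x else 0) = F (int m - 1)"
        using less[of "m - 1"] F0 by (auto simp: 3 of_nat_diff not_le)
      moreover have "(if m \<ge> 2 then poly (p (m - 2)) x else 0) = F (int m - 2)"
        using less[of "m - 2"] F0 by (cases "m = 0"; cases "m = 1") (auto simp: 3 of_nat_diff)
      ultimately show ?thesis
        unfolding 3 p using less[of m] less[of "m + 1"] F[of "int m"] by (simp add: 3 add.commute)
    qed
  qed
  then show ?thesis
    unfolding chebyshev_T_plus_U[OF t1] by (simp add: x_def F_def u_def v_def c_def)
qed

end
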